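(* Let $M$ be a real symmetric $d\times d$ matrix, $J$ a constant real negative semidefinite $d\times d$ matrix, $U:\mathbb{R}^d\to\mathbb{R}$ a polynomial, and $p$ a positive integer. Let $\bar U:(\mathbb{R}^d)^p\to\mathbb{R}$ be a quadratic polarization of $U$ in $p$ arguments and let $\overline{\nabla}\bar U$ be a polarized discrete gradient for $\bar U$. Let $h>0$ and let $(y_n)_{n\ge0}$ be a sequence in $\mathbb{R}^d$ satisfying, for all $n\ge0$, the scheme $$y_{n+p}=\exp(phJM)\,y_n+ph\,\phi(phJM)\,J\,\overline{\nabla}\bar U(y_n,y_{n+1},\dots,y_{n+p}).$$ Then, with $$\bar H(y_n,\dots,y_{n+p-1})=\frac1{2p}\sum_{i=0}^{p-1}y_{n+i}^TMy_{n+i}+\bar U(y_n,\dots,y_{n+p-1}),$$ the scheme preserves the polarized Lyapunov function $\bar H$ in the sense that $$\bar H(y_{n+1},\dots,y_{n+p})\le\bar H(y_n,\dots,y_{n+p-1})\qquad\text{for all } n\ge0.$$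
   Context: The scheme is a numerical method with step size $h$ for the system $\dot y=J\nabla H(y)=JMy+J\nabla U(y)$ with $H(y)=\frac12y^TMy+U(y)$. A real square matrix $J$, not necessarily symmetric, is negative semidefinite if $x^TJx\le0$ for all $x\in\mathbb{R}^d$. $\phi$ is the entire function $\phi(z)=\frac{e^z-1}{z}$ (with $\phi(0)=1$), and for a square matrix $V$, $\phi(V)=\sum_{k\ge0}\frac{V^k}{(k+1)!}$. A quadratic polarization of $U$ in $p$ arguments is a polynomial function $\bar U(x_1,\dots,x_p)$, of degree at most two in each of the vector arguments $x_i\in\mathbb{R}^d$, that is consistent with $U$, i.e. $\bar U(x,\dots,x)=U(x)$, and invariant under cyclic permutation of its arguments, i.e. $\bar U(x_1,x_2,\dots,x_p)=\bar U(x_2,\dots,x_p,x_1)$. A polarized discrete gradient for $\bar U$ is a map $\overline{\nabla}\bar U:(\mathbb{R}^d)^{p+1}\to\mathbb{R}^d$ such that for all $x_0,\dots,x_p,x\in\mathbb{R}^d$: $$\bar U(x_1,\dots,x_p)-\bar U(x_0,\dots,x_{p-1})=\tfrac1p(x_p-x_0)^T\,\overline{\nabla}\bar U(x_0,\dots,x_p),\qquad \overline{\nabla}\bar U(x,\dots,x)=\nabla U(x).$$ *)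

theory Defs
  imports "HOL-Analysis.Analysis"
begin

definition neg_semidefinite :: "real^'d^'d \<Rightarrow> bool" where
  "neg_semidefinite J \<longleftrightarrow> (\<forall>x. x \<bullet> (J *v x) \<le> 0)"

(* The operators * and ^ act componentwise on type vec, so matrix powers, and the
   matrix power series below, are built from the matrix product **. *)
primrec matrix_power :: "real^'d^'d \<Rightarrow> nat \<Rightarrow> real^'d^'d" where
  "matrix_power A 0 = mat 1"
| "matrix_power A (Suc k) = A ** matrix_power A k"

definition matrix_exp :: "real^'d^'d \<Rightarrow> real^'d^'d" where
  "matrix_exp V = (\<Sum>k. (1 / fact k) *\<^sub>R matrix_power V k)"

definition matrix_phi :: "real^'d^'d \<Rightarrow> real^'d^'d" where
  "matrix_phi V = (\<Sum>k. (1 / fact (k + 1)) *\<^sub>R matrix_power V k)"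

(* A function of p vector arguments is a function on lists; only its values on
   lists of length p are meaningful, and every condition is restricted to these. *)

(* The exponent of the variable (xs ! i) $ k in the monomial indexed by a is a i k;
   degree at most two in the argument i means total degree in the components of xs ! i. *)
definition polynomial_quadratic_in_each ::
  "nat \<Rightarrow> ((real^'d) list \<Rightarrow> real) \<Rightarrow> bool" where
  "polynomial_quadratic_in_each p Ubar \<longleftrightarrow>
     (\<exists>(A :: (nat \<Rightarrow> 'd \<Rightarrow> nat) set) (c :: (nat \<Rightarrow> 'd \<Rightarrow> nat) \<Rightarrow> real).
        finite A \<and>
        (\<forall>a\<in>A. \<forall>i<p. (\<Sum>k\<in>UNIV. a i k) \<le> 2) \<and>
        (\<forall>xs. length xs = p \<longrightarrow>
           Ubar xs = (\<Sum>a\<in>A. c a * (\<Prod>i<p. \<Prod>k\<in>UNIV. ((xs ! i) $ k) ^ a i k))))"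

definition quadratic_polarization ::
  "nat \<Rightarrow> (real^'d \<Rightarrow> real) \<Rightarrow> ((real^'d) list \<Rightarrow> real) \<Rightarrow> bool" where
  "quadratic_polarization p U Ubar \<longleftrightarrow>
     polynomial_quadratic_in_each p Ubar \<and>
     (\<forall>x. Ubar (replicate p x) = U x) \<and>
     (\<forall>xs. length xs = p \<longrightarrow> Ubar xs = Ubar (rotate1 xs))"

(* For xs = [x_0, ..., x_p]: tl xs = [x_1, ..., x_p] and butlast xs = [x_0, ..., x_(p-1)]. *)
definition polarized_discrete_gradient ::
  "nat \<Rightarrow> (real^'d \<Rightarrow> real) \<Rightarrow> ((real^'d) list \<Rightarrow> real) \<Rightarrow> ((real^'d) list \<Rightarrow> real^'d) \<Rightarrow> bool" where
  "polarized_discrete_gradient p U Ubar G \<longleftrightarrow>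
     (\<forall>xs. length xs = p + 1 \<longrightarrow>
        Ubar (tl xs) - Ubar (butlast xs) = (1 / real p) * ((xs ! p - xs ! 0) \<bullet> G xs)) \<and>
     (\<forall>x. GDERIV U x :> G (replicate (p + 1) x))"

definition polarized_lyapunov ::
  "nat \<Rightarrow> real^'d^'d \<Rightarrow> ((real^'d) list \<Rightarrow> real) \<Rightarrow> (real^'d) list \<Rightarrow> real" where
  "polarized_lyapunov p M Ubar xs =
     (1 / (2 * real p)) * (\<Sum>i<p. (xs ! i) \<bullet> (M *v (xs ! i))) + Ubar xs"

end

theory Submission
  imports Defs
begin

text \<open>
  With \<open>t = p h\<close>, \<open>A = J M\<close> and \<open>g\<close> the value of the discrete gradient, \<open>y (n + p)\<close> is the time-\<open>t\<close>
  value of the solution of the affine equation \<open>u' = A u + J g = J (M u + g)\<close> with \<open>u 0 = y n\<close>.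
  Along it, \<open>u \<bullet> M u / 2 + u \<bullet> g\<close> has derivative \<open>(M u + g) \<bullet> J (M u + g) \<le> 0\<close>. The polarized
  Lyapunov functions at \<open>n + 1\<close> and \<open>n\<close> differ by exactly \<open>1 / p\<close> times the increment of this energy,
  as all but the outer terms of the quadratic part cancel.
\<close>

text \<open>Taking the inner product with each basis vector reduces the claim to termwise
  differentiation of a scalar power series; convergence for every \<open>s\<close> leaves no radius
  to track. Summability of the derived series is assumed because the inner product must be moved
  inside that sum too.\<close>

lemma power_series_has_vector_derivative:
  fixes c :: "nat \<Rightarrow> 'a::euclidean_space"
  assumes "\<And>s. summable (\<lambda>n. s ^ n *\<^sub>R c n)"
    and "summable (\<lambda>n. t ^ n *\<^sub>R (real (Suc n) *\<^sub>R c (Suc n)))"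
  shows "((\<lambda>s. \<Sum>n. s ^ n *\<^sub>R c n) has_vector_derivative
           (\<Sum>n. t ^ n *\<^sub>R (real (Suc n) *\<^sub>R c (Suc n)))) (at t)"
proof -
  have "((\<lambda>s. (\<Sum>n. s ^ n *\<^sub>R c n) \<bullet> b) has_derivative
          (\<lambda>x. (x *\<^sub>R (\<Sum>n. t ^ n *\<^sub>R (real (Suc n) *\<^sub>R c (Suc n)))) \<bullet> b)) (at t)" for b
  proof -
    have inner_suminf: "(\<Sum>n. f n) \<bullet> b = (\<Sum>n. f n \<bullet> b)" if "summable f" for f :: "nat \<Rightarrow> 'a"
      using bounded_linear.suminf[OF bounded_linear_inner_left that] by simp
    have summ: "summable (\<lambda>n. (c n \<bullet> b) * s ^ n)" for s
      using bounded_linear.summable[OF bounded_linear_inner_left assms(1), of s b]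
      by (simp add: mult.commute)
    have "DERIV (\<lambda>s. \<Sum>n. (c n \<bullet> b) * s ^ n) t :> (\<Sum>n. diffs (\<lambda>n. c n \<bullet> b) n * t ^ n)"
      using summ by (rule termdiffs_strong_converges_everywhere)
    moreover have "(\<Sum>n. (c n \<bullet> b) * s ^ n) = (\<Sum>n. s ^ n *\<^sub>R c n) \<bullet> b" for s
      by (simp add: inner_suminf[OF assms(1)] mult.commute)
    moreover have "(\<Sum>n. diffs (\<lambda>n. c n \<bullet> b) n * t ^ n) =
        (\<Sum>n. t ^ n *\<^sub>R (real (Suc n) *\<^sub>R c (Suc n))) \<bullet> b"
      unfolding inner_suminf[OF assms(2)] by (simp add: diffs_def mult_ac)
    ultimately show ?thesis
      by (simp add: has_field_derivative_def mult_commute_abs)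
  qed
  then show ?thesis
    unfolding has_vector_derivative_def by (subst has_derivative_componentwise_within) blast
qed

lemma bounded_bilinear_matrix_mult:
  "bounded_bilinear ((**) :: real^'d^'d \<Rightarrow> real^'d^'d \<Rightarrow> real^'d^'d)"
  by (intro bilinear_conv_bounded_bilinear[THEN iffD1])
     (auto simp: bilinear_def linear_iff matrix_matrix_mult_def vec_eq_iff sum.distrib
       sum_distrib_left algebra_simps)

lemma bounded_bilinear_matrix_vector_mult:
  "bounded_bilinear ((*v) :: real^'d^'d \<Rightarrow> real^'d \<Rightarrow> real^'d)"
  by (intro bilinear_conv_bounded_bilinear[THEN iffD1])
     (auto simp: bilinear_def linear_iff matrix_vector_mult_def vec_eq_iff sum.distrib
       sum_distrib_left algebra_simps)

lemma matrix_power_scaleR: "matrix_power (t *\<^sub>R A) k = t ^ k *\<^sub>R matrix_power A k"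
  by (induction k)
     (auto simp: bounded_bilinear.scaleR_left[OF bounded_bilinear_matrix_mult]
       bounded_bilinear.scaleR_right[OF bounded_bilinear_matrix_mult])

text \<open>Induction with \<open>C = norm A * K\<close>, where \<open>K\<close> bounds the bilinear
  matrix product; the factor \<open>norm (mat 1)\<close> comes from the zeroth power.\<close>

lemma norm_matrix_power_le:
  fixes A :: "real^'d^'d"
  obtains C where "\<And>k. norm (matrix_power A k) \<le> norm (mat 1 :: real^'d^'d) * C ^ k"
proof -
  obtain K where K: "K > 0" "\<And>(A::real^'d^'d) B :: real^'d^'d. norm (A ** B) \<le> norm A * norm B * K"
    using bounded_bilinear.pos_bounded[OF bounded_bilinear_matrix_mult] by blast
  have "norm (matrix_power A k) \<le> norm (mat 1 :: real^'d^'d) * (norm A * K) ^ k" for k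
  proof (induction k)
    case (Suc k)
    have "norm (matrix_power A (Suc k)) \<le> norm A * K * norm (matrix_power A k)"
      using K(2)[of A "matrix_power A k"] by (simp add: mult_ac)
    also have "\<dots> \<le> norm A * K * (norm (mat 1 :: real^'d^'d) * (norm A * K) ^ k)"
      using K(1) by (intro mult_left_mono Suc.IH) auto
    finally show ?case by (simp add: mult_ac)
  qed simp
  then show ?thesis by (rule that)
qed

text \<open>Comparison with a multiple of the scalar exponential series. The bound on
  \<open>r\<close> covers the coefficients of both \<open>matrix_exp\<close> and
  \<open>matrix_phi\<close>.\<close>

lemma summable_matrix_power_series:
  fixes A :: "real^'d^'d"
  assumes "\<And>k. \<bar>r k\<bar> \<le> 1 / fact k"
  shows "summable (\<lambda>k. r k *\<^sub>R matrix_power A k)"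
proof -
  obtain C where C: "\<And>k. norm (matrix_power A k) \<le> norm (mat 1 :: real^'d^'d) * C ^ k"
    using norm_matrix_power_le[of A] by blast
  have "summable (\<lambda>k. norm (mat 1 :: real^'d^'d) * (inverse (fact k) * C ^ k))"
    by (intro summable_mult summable_exp)
  moreover have "norm (r k *\<^sub>R matrix_power A k) \<le> norm (mat 1 :: real^'d^'d) * (inverse (fact k) * C ^ k)" for k
    using mult_mono[OF assms[of k] C[of k]] by (simp add: field_simps)
  ultimately show ?thesis
    by (rule summable_comparison_test'[where N = 0])
qed

lemma summable_matrix_exp: "summable (\<lambda>k. (1 / fact k) *\<^sub>R matrix_power V k)"
  by (rule summable_matrix_power_series) simp

lemma summable_matrix_phi: "summable (\<lambda>k. (1 / fact (k + 1)) *\<^sub>R matrix_power V k)"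
  by (rule summable_matrix_power_series) (simp add: divide_simps fact_mono del: fact_Suc)

text \<open>Without its zeroth term, the exponential series has a common left factor
  \<open>V\<close>. This form of phi(z) = (e^z - 1)/z needs no inverse of \<open>V\<close>.\<close>

lemma matrix_exp_eq_matrix_phi: "matrix_exp V = mat 1 + V ** matrix_phi V"
proof -
  have "matrix_exp V = (\<Sum>k. (1 / fact (Suc k)) *\<^sub>R matrix_power V (Suc k)) + mat 1"
    using suminf_split_initial_segment[OF summable_matrix_exp[of V], of 1]
    by (simp add: matrix_exp_def del: fact_Suc)
  also have "(\<Sum>k. (1 / fact (Suc k)) *\<^sub>R matrix_power V (Suc k)) = V ** matrix_phi V"
    using bounded_linear.suminf[OF bounded_bilinear.bounded_linear_right[OF bounded_bilinear_matrix_mult]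
        summable_matrix_phi, of V V]
    by (simp add: matrix_phi_def bounded_bilinear.scaleR_right[OF bounded_bilinear_matrix_mult]
        del: fact_Suc)
  finally show ?thesis by simp
qed

lemma matrix_exp_has_vector_derivative:
  "((\<lambda>s. matrix_exp (s *\<^sub>R A)) has_vector_derivative A ** matrix_exp (t *\<^sub>R A)) (at t)"
proof -
  let ?c = "\<lambda>k. (1 / fact k) *\<^sub>R matrix_power A k"
  have series: "s ^ k *\<^sub>R ?c k = (1 / fact k) *\<^sub>R matrix_power (s *\<^sub>R A) k" for s k
    by (simp add: matrix_power_scaleR)
  \<comment> \<open>Since (k+1)/(k+1)! = 1/k!, differentiation only shifts the series, and the
    surplus factor \<open>A\<close> comes out on the left.\<close>
  have shift: "t ^ k *\<^sub>R (real (Suc k) *\<^sub>R ?c (Suc k)) =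
      A ** ((1 / fact k) *\<^sub>R matrix_power (t *\<^sub>R A) k)" for k
    by (simp add: matrix_power_scaleR bounded_bilinear.scaleR_right[OF bounded_bilinear_matrix_mult])
  note linear = bounded_bilinear.bounded_linear_right[OF bounded_bilinear_matrix_mult]
  have "summable (\<lambda>k. t ^ k *\<^sub>R (real (Suc k) *\<^sub>R ?c (Suc k)))"
    unfolding shift by (rule bounded_linear.summable[OF linear summable_matrix_exp])
  moreover have "summable (\<lambda>k. s ^ k *\<^sub>R ?c k)" for s
    unfolding series by (rule summable_matrix_exp)
  ultimately have "((\<lambda>s. \<Sum>k. s ^ k *\<^sub>R ?c k) has_vector_derivative
      (\<Sum>k. t ^ k *\<^sub>R (real (Suc k) *\<^sub>R ?c (Suc k)))) (at t)"
    by (intro power_series_has_vector_derivative)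
  then show ?thesis
    unfolding shift series bounded_linear.suminf[OF linear summable_matrix_exp, symmetric]
      matrix_exp_def[symmetric] .
qed

text \<open>s phi(sA) is the integral of exp(rA) over r from 0 to s. Treating it as one power series
  in \<open>s\<close> avoids differentiating \<open>matrix_phi\<close> itself.\<close>

lemma matrix_phi_has_vector_derivative:
  "((\<lambda>s. s *\<^sub>R matrix_phi (s *\<^sub>R A)) has_vector_derivative matrix_exp (t *\<^sub>R A)) (at t)"
proof -
  \<comment> \<open>The factor \<open>s\<close> raises each exponent by one, so the coefficients of
    phi move up one index and the constant term is 0.\<close>
  let ?c = "\<lambda>k. case k of 0 \<Rightarrow> 0 | Suc j \<Rightarrow> (1 / fact (j + 1)) *\<^sub>R matrix_power A j"
  have sums: "(\<lambda>k. s ^ k *\<^sub>R ?c k) sums (s *\<^sub>R matrix_phi (s *\<^sub>R A))" for s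
  proof -
    have "(\<lambda>k. s *\<^sub>R ((1 / fact (k + 1)) *\<^sub>R matrix_power (s *\<^sub>R A) k)) sums (s *\<^sub>R matrix_phi (s *\<^sub>R A))"
      unfolding matrix_phi_def by (intro sums_scaleR_right summable_sums summable_matrix_phi)
    also have "(\<lambda>k. s *\<^sub>R ((1 / fact (k + 1)) *\<^sub>R matrix_power (s *\<^sub>R A) k)) =
        (\<lambda>k. s ^ Suc k *\<^sub>R ?c (Suc k))"
      by (simp add: matrix_power_scaleR mult_ac del: fact_Suc)
    finally show ?thesis by (subst (asm) sums_Suc_iff) simp
  qed
  have shift: "t ^ k *\<^sub>R (real (Suc k) *\<^sub>R ?c (Suc k)) =
      (1 / fact k) *\<^sub>R matrix_power (t *\<^sub>R A) k" for k
    by (simp add: matrix_power_scaleR)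
  have "summable (\<lambda>k. t ^ k *\<^sub>R (real (Suc k) *\<^sub>R ?c (Suc k)))"
    unfolding shift by (rule summable_matrix_exp)
  with sums_summable[OF sums] have "((\<lambda>s. \<Sum>k. s ^ k *\<^sub>R ?c k) has_vector_derivative
      (\<Sum>k. t ^ k *\<^sub>R (real (Suc k) *\<^sub>R ?c (Suc k)))) (at t)"
    by (rule power_series_has_vector_derivative)
  then show ?thesis
    unfolding shift sums[THEN sums_unique, symmetric] matrix_exp_def[symmetric] .
qed

text \<open>Variation of constants for u' = A u + b, u(0) = x: the constant forcing \<open>b\<close>
  contributes the integral of exp(rA) b, which is s phi(sA) b.\<close>

lemma affine_flow_has_vector_derivative:
  fixes A :: "real^'d^'d"
  defines "u \<equiv> \<lambda>s x b. matrix_exp (s *\<^sub>R A) *v x + s *\<^sub>R (matrix_phi (s *\<^sub>R A) *v b)"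
  shows "((\<lambda>s. u s x b) has_vector_derivative A *v u t x b + b) (at t)"
proof -
  have deriv: "((\<lambda>s. F s *v v) has_vector_derivative F' *v v) (at t)"
    if "(F has_vector_derivative F') (at t)" for F :: "real \<Rightarrow> real^'d^'d" and F' v
    using bounded_linear.has_vector_derivative[OF
        bounded_bilinear.bounded_linear_left[OF bounded_bilinear_matrix_vector_mult] that] .
  have u: "u s x b = matrix_exp (s *\<^sub>R A) *v x + (s *\<^sub>R matrix_phi (s *\<^sub>R A)) *v b" for s
    by (simp add: u_def scaleR_matrix_vector_assoc)
  have "((\<lambda>s. u s x b) has_vector_derivative
      (A ** matrix_exp (t *\<^sub>R A)) *v x + matrix_exp (t *\<^sub>R A) *v b) (at t)"
    unfolding u by (intro has_vector_derivative_add deriv matrix_exp_has_vector_derivative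
        matrix_phi_has_vector_derivative)
  also have "(A ** matrix_exp (t *\<^sub>R A)) *v x + matrix_exp (t *\<^sub>R A) *v b = A *v u t x b + b"
    \<comment> \<open>Only the exponential acting on \<open>b\<close> is expanded, as 1 + tA
      phi(tA): the first summand gives \<open>b\<close>, the second is \<open>A\<close> applied to
      the forcing part of \<open>u t x b\<close>.\<close>
    by (subst (2) matrix_exp_eq_matrix_phi)
       (simp add: u matrix_vector_right_distrib matrix_vector_mult_add_rdistrib
         matrix_vector_mul_assoc bounded_bilinear.scaleR_left[OF bounded_bilinear_matrix_mult]
         bounded_bilinear.scaleR_right[OF bounded_bilinear_matrix_mult])
  finally show ?thesis .
qed

lemma affine_flow_energy_le:
  fixes M J :: "real^'d^'d"
  assumes M: "transpose M = M" and J: "neg_semidefinite J" and "t \<ge> 0"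
    and z: "z = matrix_exp (t *\<^sub>R (J ** M)) *v x + t *\<^sub>R (matrix_phi (t *\<^sub>R (J ** M)) *v (J *v g))"
  shows "z \<bullet> (M *v z) / 2 + z \<bullet> g \<le> x \<bullet> (M *v x) / 2 + x \<bullet> g"
proof -
  define A where "A = J ** M"
  define u where "u s = matrix_exp (s *\<^sub>R A) *v x + s *\<^sub>R (matrix_phi (s *\<^sub>R A) *v (J *v g))" for s
  define E where "E v = v \<bullet> (M *v v) / 2 + v \<bullet> g" for v
  have "\<exists>D. DERIV (\<lambda>s. E (u s)) s :> D \<and> D \<le> 0" for s
  proof -
    \<comment> \<open>As \<open>M\<close> is symmetric, \<open>?q\<close> is the gradient of
      \<open>E\<close> at \<open>u s\<close>, so the flow reads u' = J grad E(u).\<close>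
    let ?q = "M *v u s + g"
    have "(u has_vector_derivative A *v u s + J *v g) (at s)"
      unfolding u_def by (rule affine_flow_has_vector_derivative)
    then have du: "(u has_vector_derivative J *v ?q) (at s)"
      by (simp add: A_def matrix_vector_mul_assoc matrix_vector_right_distrib)
    have dMu: "((\<lambda>s. M *v u s) has_vector_derivative M *v (J *v ?q)) (at s)"
      using bounded_linear.has_vector_derivative[OF matrix_vector_mul_bounded_linear du] .
    have "((\<lambda>s. E (u s)) has_vector_derivative
        (u s \<bullet> (M *v (J *v ?q)) + (J *v ?q) \<bullet> (M *v u s)) / 2 + (J *v ?q) \<bullet> g) (at s)"
      unfolding E_def
      by (intro has_vector_derivative_add has_vector_derivative_divide
          bounded_bilinear.has_vector_derivative[OF bounded_bilinear_inner du dMu]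
          bounded_linear.has_vector_derivative[OF bounded_linear_inner_left du])
    \<comment> \<open>Symmetry of \<open>M\<close> makes both halves of the quadratic term's
      derivative equal, so the total is the inner product of \<open>J *v ?q\<close> with
      \<open>?q\<close>.\<close>
    moreover have "u s \<bullet> (M *v (J *v ?q)) = (J *v ?q) \<bullet> (M *v u s)"
      by (metis M dot_lmul_matrix inner_commute transpose_matrix_vector)
    ultimately have "DERIV (\<lambda>s. E (u s)) s :> ?q \<bullet> (J *v ?q)"
      by (simp add: has_real_derivative_iff_has_vector_derivative inner_add_right inner_add_left inner_commute)
    then show ?thesis
      using J unfolding neg_semidefinite_def by blast
  qed
  then have "E (u t) \<le> E (u 0)"
    using \<open>t \<ge> 0\<close> by (intro DERIV_nonpos_imp_nonincreasing[of 0 t]) auto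
  moreover have "u 0 = x"
    using matrix_exp_eq_matrix_phi[of "0 :: real^'d^'d"] by (simp add: u_def)
  moreover have "u t = z"
    by (simp add: u_def z A_def)
  ultimately show ?thesis by (simp add: E_def)
qed

theorem corollary2:
  fixes M J :: "real^'d^'d"
    and U :: "real^'d \<Rightarrow> real"
    and Ubar :: "(real^'d) list \<Rightarrow> real"
    and G :: "(real^'d) list \<Rightarrow> real^'d"
    and p :: nat and h :: real
    and y :: "nat \<Rightarrow> real^'d"
  assumes "transpose M = M"
    and "neg_semidefinite J"
    and "real_polynomial_function U"
    and "p > 0"
    and "quadratic_polarization p U Ubar"
    and "polarized_discrete_gradient p U Ubar G"
    and "h > 0"
    and "\<And>n. y (n + p) =
           matrix_exp ((real p * h) *\<^sub>R (J ** M)) *v y n +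
           (real p * h) *\<^sub>R
             ((matrix_phi ((real p * h) *\<^sub>R (J ** M)) ** J) *v G (map y [n..<n + p + 1]))"
  shows "\<forall>n. polarized_lyapunov p M Ubar (map y [n + 1..<n + p + 1])
             \<le> polarized_lyapunov p M Ubar (map y [n..<n + p])"
proof
  fix n
  let ?t = "real p * h" and ?xs = "map y [n..<n + p + 1]"
  define x z g where "x = y n" and "z = y (n + p)" and "g = G ?xs"
  define q where "q i = y i \<bullet> (M *v y i)" for i
  \<comment> \<open>The scheme is implicit, since \<open>g\<close> depends on \<open>z\<close>; but
    for a given sequence \<open>g\<close> is a fixed vector, so the flow with constant forcing
    \<open>J *v g\<close> applies.\<close>
  have energy: "z \<bullet> (M *v z) / 2 + z \<bullet> g \<le> x \<bullet> (M *v x) / 2 + x \<bullet> g"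
  proof (rule affine_flow_energy_le[OF assms(1,2), of ?t])
    show "0 \<le> ?t" using assms(7) by simp
    show "z = matrix_exp (?t *\<^sub>R (J ** M)) *v x + ?t *\<^sub>R (matrix_phi (?t *\<^sub>R (J ** M)) *v (J *v g))"
      using assms(8)[of n] by (simp add: x_def z_def g_def matrix_vector_mul_assoc)
  qed
  \<comment> \<open>Dropping the first or the last of the p + 1 entries of \<open>?xs\<close> gives
    the windows at n + 1 and n, the arguments in the discrete gradient identity.\<close>
  have tl: "tl ?xs = map y [n + 1..<n + p + 1]"
    by (simp add: map_tl[symmetric] tl_upt del: upt_Suc)
  have butlast: "butlast ?xs = map y [n..<n + p]"
    by (simp add: map_butlast[symmetric])
  have "Ubar (tl ?xs) - Ubar (butlast ?xs) = (1 / real p) * ((?xs ! p - ?xs ! 0) \<bullet> G ?xs)"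
    using assms(6) unfolding polarized_discrete_gradient_def by (simp del: upt_Suc)
  then have U: "Ubar (map y [n + 1..<n + p + 1]) - Ubar (map y [n..<n + p]) = ((z - x) \<bullet> g) / p"
    unfolding tl butlast g_def[symmetric] by (simp add: x_def z_def del: upt_Suc)
  have "(\<Sum>i<p. q (n + 1 + i)) - (\<Sum>i<p. q (n + i)) = q (n + p) - q n"
    unfolding sum_subtractf[symmetric] using sum_lessThan_telescope[of "\<lambda>i. q (n + i)" p] by simp
  then have "polarized_lyapunov p M Ubar (map y [n + 1..<n + p + 1]) -
      polarized_lyapunov p M Ubar (map y [n..<n + p]) = (q (n + p) - q n) / (2 * p) + ((z - x) \<bullet> g) / p"
    using U unfolding polarized_lyapunov_def q_def
    by (simp add: diff_divide_distrib[symmetric] add_divide_distrib[symmetric] field_simps del: upt_Suc)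
  also have "\<dots> = ((z \<bullet> (M *v z) / 2 + z \<bullet> g) - (x \<bullet> (M *v x) / 2 + x \<bullet> g)) / p"
    using assms(4) by (simp add: q_def x_def z_def divide_simps inner_diff_left)
  also have "\<dots> \<le> 0"
    using energy by (simp add: divide_nonpos_nonneg)
  finally show "polarized_lyapunov p M Ubar (map y [n + 1..<n + p + 1]) \<le>
      polarized_lyapunov p M Ubar (map y [n..<n + p])"
    by simp
qed

end
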